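(* Let $n\ge1$ be an integer, $\alpha>0$, $M=\mathbb{R}^n\setminus\{0\}$ and $d\mu(x)=e^{-1/|x|^{\alpha}}dx$. There exist constants $C>0$ and $\tau\in(0,1)$ such that the function $$\tilde I(v)=\begin{cases} C\,v\big(\log\frac1v\big)^{1+\frac1\alpha}, & 0\le v\le\tau,\\ C\,v^{\frac{n-1}{n}}, & v>\tau,\end{cases}$$ (with $\tilde I(0)=0$) is a lower isoperimetric function for the measure $\mu$ on $M$, i.e. $\mu^+(A)\ge \tilde I(\mu(A))$ for every Borel set $A\subset M$.
   Context: For a Borel set $A\subset M$, its perimeter is $\mu^+(A)=\liminf_{r\to0^+}\frac{\mu(A^r)-\mu(A)}{r}$, where $A^r$ is the $r$-neighborhood of $A$ in $M$ with respect to the Euclidean metric. A function $J$ is a lower isoperimetric function of $\mu$ if $\mu^+(A)\ge J(\mu(A))$ for all Borel $A\subset M$. *)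

theory Defs
  imports "HOL-Analysis.Analysis"
begin

definition Mset :: "'a::euclidean_space set" where
  "Mset = UNIV - {0}"

definition mu :: "real \<Rightarrow> 'a::euclidean_space measure" where
  "mu \<alpha> = density lborel
     (\<lambda>x. ennreal (indicator Mset x * exp (- 1 / (norm x powr \<alpha>))))"

definition nbhd :: "'a::euclidean_space set \<Rightarrow> real \<Rightarrow> 'a set" where
  "nbhd A r = {x \<in> Mset. \<exists>a\<in>A. dist x a < r}"

definition perimeter :: "real \<Rightarrow> 'a::euclidean_space set \<Rightarrow> ereal" where
  "perimeter \<alpha> A = Liminf (at_right 0)
     (\<lambda>r. (enn2ereal (emeasure (mu \<alpha>) (nbhd A r)) - enn2ereal (emeasure (mu \<alpha>) A)) / ereal r)"

definition Itilde :: "real \<Rightarrow> real \<Rightarrow> real \<Rightarrow> nat \<Rightarrow> real \<Rightarrow> real" where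
  "Itilde C \<tau> \<alpha> n v =
     (if v \<le> \<tau> then C * v * (ln (1 / v)) powr (1 + 1 / \<alpha>)
      else C * v powr ((real n - 1) / real n))"

end

theory Submission
  imports Defs "HOL-Real_Asymp.Real_Asymp"
begin

text \<open>The density increases with the norm. Move each point \<open>x\<close> of \<open>A\<close> along a straight outward path
  \<open>t \<mapsto> x + t (\<kappa> x + h)\<close>, with \<open>\<kappa> \<ge> 0\<close> and \<open>h \<bullet> x \<ge> 0\<close>: the mass of the points that end outside \<open>A\<close>
  is at most the length of the paths times the perimeter. Two choices of paths suffice, where
  \<open>v = \<mu>(A)\<close>. Translations by a random \<open>h\<close> in a half ball of radius \<open>R\<close> show that the perimeter is at
  least of order \<open>v / R\<close> if half of \<open>A\<close> lies where the density exceeds \<open>4 v / |B\<^sub>R|\<close>. Dilations by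
  \<open>1 + \<kappa>\<close> show that it is at least of order \<open>v / (\<kappa> \<rho>)\<close> if half of \<open>A\<close> lies in the ball of radius \<open>\<rho>\<close>
  and the dilation multiplies the mass in that ball by at least \<open>4\<close>. For large \<open>v\<close> take \<open>\<rho> = 1\<close>,
  \<open>\<kappa> = 3\<close> and \<open>R\<close> of order \<open>v\<^bsup>1/n\<^esup>\<close>. For small \<open>v\<close> put \<open>l = log (1/v)\<close> and choose \<open>\<rho>\<close> so that the
  density is \<open>v\<^bsup>1/2\<^esup>\<close> on the sphere of radius \<open>\<rho>\<close>, that is \<open>\<rho>\<^bsup>-\<alpha>\<^esup> = l/2\<close>; then \<open>\<kappa>\<close> of order \<open>1/l\<close> and \<open>R\<close>
  of order \<open>v\<^bsup>1/(2n)\<^esup>\<close> work.\<close>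

section \<open>The density and its monotonicity\<close>

text \<open>On its own, the exponential would equal 1 at the origin, because division by zero gives
  0. The indicator sets this value to 0, so for \<alpha> > 0 the density is monotone in the norm on
  the whole space.\<close>

definition weight :: "real \<Rightarrow> 'a::euclidean_space \<Rightarrow> real" where
  "weight \<alpha> x = indicator Mset x * exp (- 1 / (norm x powr \<alpha>))"

lemma mu_eq_weight: "mu \<alpha> = density lborel (\<lambda>x. ennreal (weight \<alpha> x))"
  by (simp add: mu_def weight_def)

lemma weight_nonneg [simp]: "0 \<le> weight \<alpha> x"
  by (simp add: weight_def)

lemma weight_eq: "x \<noteq> 0 \<Longrightarrow> weight \<alpha> x = exp (- 1 / (norm x powr \<alpha>))"
  by (simp add: weight_def Mset_def)

lemma weight_0 [simp]: "weight \<alpha> 0 = 0"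
  by (simp add: weight_def Mset_def)

lemma weight_mono:
  assumes "\<alpha> > 0" "norm x \<le> norm y"
  shows "weight \<alpha> x \<le> weight \<alpha> y"
proof (cases "x = 0")
  case False
  then have "y \<noteq> 0" using assms(2) by auto
  have "norm x powr \<alpha> \<le> norm y powr \<alpha>" using assms by (intro powr_mono2) auto
  then show ?thesis using False \<open>y \<noteq> 0\<close> by (simp add: weight_eq field_simps)
qed simp

lemma Mset_borel [measurable]: "Mset \<in> sets (borel :: 'a::euclidean_space measure)"
  by (simp add: Mset_def)

lemma weight_measurable [measurable]: "weight \<alpha> \<in> borel_measurable borel"
  unfolding weight_def by measurable

lemma sets_mu [simp, measurable_cong]: "sets (mu \<alpha>) = sets borel"
  by (simp add: mu_def)

lemma space_mu [simp]: "space (mu \<alpha>) = UNIV"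
  by (simp add: mu_def)

lemma emeasure_mu:
  assumes [measurable]: "B \<in> sets borel"
  shows "emeasure (mu \<alpha>) B = (\<integral>\<^sup>+x. ennreal (weight \<alpha> x) * indicator B x \<partial>lborel)"
  unfolding mu_eq_weight by (subst emeasure_density) auto

lemma nbhd_borel [measurable]: "nbhd A r \<in> sets (borel :: 'a::euclidean_space measure)"
proof -
  have "nbhd A r = Mset \<inter> (\<Union>a\<in>A. ball a r)"
    by (auto simp: nbhd_def dist_commute)
  then show ?thesis by (simp add: borel_open open_UN Mset_borel)
qed

section \<open>Mass leaving a set along straight outward paths\<close>

lemma nn_integral_lborel_affine:
  fixes g :: "'a::euclidean_space \<Rightarrow> ennreal" and c :: real
  assumes [measurable]: "g \<in> borel_measurable borel" and "c \<noteq> 0"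
  shows "(\<integral>\<^sup>+x. g x \<partial>lborel) = ennreal (\<bar>c\<bar> ^ DIM('a)) * (\<integral>\<^sup>+x. g (t + c *\<^sub>R x) \<partial>lborel)"
  by (subst lborel_affine[OF \<open>c \<noteq> 0\<close>, of t])
     (simp add: nn_integral_density nn_integral_distr nn_integral_cmult)

text \<open>A point of \<open>G\<close> leaves \<open>A\<close> during one of \<open>m\<close> steps shorter than \<open>r\<close> along its straight path,
  and lands in \<open>nbhd A r - A\<close>; neither the weight nor the volume decreases along the paths.\<close>

lemma flux_bound:
  fixes A :: "'a::euclidean_space set"
  assumes "\<alpha> > 0" and [measurable]: "A \<in> sets borel" "G \<in> sets borel"
    and "A \<subseteq> Mset" "G \<subseteq> A" "\<kappa> \<ge> 0"
    and speed: "\<And>x. x \<in> G \<Longrightarrow> norm (\<kappa> *\<^sub>R x + h) \<le> L"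
    and outward: "\<And>x. x \<in> G \<Longrightarrow> h \<bullet> x \<ge> 0"
    and "r > 0" "L < real m * r"
  shows "emeasure (mu \<alpha>) {x \<in> G. x + (\<kappa> *\<^sub>R x + h) \<notin> A}
    \<le> of_nat m * emeasure (mu \<alpha>) (nbhd A r - A)"
proof -
  define \<gamma> where "\<gamma> t x = x + t *\<^sub>R (\<kappa> *\<^sub>R x + h)" for t :: real and x
  have \<gamma>_affine: "\<gamma> t x = t *\<^sub>R h + (1 + t * \<kappa>) *\<^sub>R x" for t x
    by (simp add: \<gamma>_def algebra_simps)
  have [measurable]: "\<gamma> t \<in> borel_measurable borel" for t
    unfolding \<gamma>_def by measurable
  \<comment> \<open>The index is shifted: \<open>E j\<close> refers to the position after step
    \<open>j + 1\<close>, the first one that can lie outside \<open>A\<close>.\<close>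
  define E where "E j = {x \<in> G. \<gamma> (real (Suc j) / real m) x \<in> nbhd A r - A}" for j
  have [measurable]: "E j \<in> sets borel" for j
    unfolding E_def by measurable
  \<comment> \<open>The velocity \<open>w\<close> has \<open>x \<bullet> w = \<kappa> (x \<bullet>
    x) + h \<bullet> x \<ge> 0\<close>, so no term in the expansion of the squared norm after
    \<open>x \<bullet> x\<close> is negative.\<close>
  have norm_mono: "norm x \<le> norm (\<gamma> t x)" if "x \<in> G" "t \<ge> 0" for x t
  proof -
    define w where "w = \<kappa> *\<^sub>R x + h"
    have "x \<bullet> w \<ge> 0"
      using outward[OF that(1)] \<open>\<kappa> \<ge> 0\<close> by (simp add: w_def inner_add_right inner_commute)
    then have "0 \<le> t * (x \<bullet> w)" using that by simp
    moreover have "\<gamma> t x \<bullet> \<gamma> t x = x \<bullet> x + 2 * (t * (x \<bullet> w)) + (t * t) * (w \<bullet> w)"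
      by (simp add: \<gamma>_def w_def[symmetric] inner_add_left inner_add_right inner_commute)
    moreover have "0 \<le> (t * t) * (w \<bullet> w)" by simp
    ultimately have "x \<bullet> x \<le> \<gamma> t x \<bullet> \<gamma> t x" by linarith
    then show ?thesis by (simp add: norm_le)
  qed
  have sub: "{x \<in> G. x + (\<kappa> *\<^sub>R x + h) \<notin> A} \<subseteq> (\<Union>j<m. E j)"
  proof
    fix x assume x: "x \<in> {x \<in> G. x + (\<kappa> *\<^sub>R x + h) \<notin> A}"
    then have xG: "x \<in> G" and "\<gamma> 1 x \<notin> A" by (auto simp: \<gamma>_def)
    \<comment> \<open>The existence of \<open>x\<close> forces \<open>L\<close> to be nonnegative,
      which excludes \<open>m = 0\<close> and makes the time steps \<open>1 / m\<close>
      meaningful.\<close>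
    have "0 \<le> L" using speed[OF xG] norm_ge_zero order_trans by blast
    then have "m > 0" using \<open>L < real m * r\<close> by (cases m) auto
    \<comment> \<open>Otherwise induction on the steps would keep the path in \<open>A\<close> up to
      time 1.\<close>
    have "\<exists>j<m. \<gamma> (real j / real m) x \<in> A \<and> \<gamma> (real (Suc j) / real m) x \<notin> A"
    proof (rule ccontr)
      assume no: "\<not> ?thesis"
      have "j \<le> m \<Longrightarrow> \<gamma> (real j / real m) x \<in> A" for j
      proof (induction j)
        case 0
        show ?case using xG \<open>G \<subseteq> A\<close> by (auto simp: \<gamma>_def)
      next
        case (Suc j)
        then show ?case using no by auto
      qed
      from this[of m] \<open>\<gamma> 1 x \<notin> A\<close> \<open>m > 0\<close> show False by simp
    qed
    then obtain j where j: "j < m" "\<gamma> (real j / real m) x \<in> A" "\<gamma> (real (Suc j) / real m) x \<notin> A"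
      by blast
    let ?z = "\<gamma> (real (Suc j) / real m) x"
    have "?z - \<gamma> (real j / real m) x = (1 / real m) *\<^sub>R (\<kappa> *\<^sub>R x + h)"
      by (simp add: \<gamma>_def add_divide_distrib scaleR_left_distrib)
    then have "dist ?z (\<gamma> (real j / real m) x) = norm (\<kappa> *\<^sub>R x + h) / real m"
      by (simp add: dist_norm)
    also have "\<dots> < r"
      using speed[OF xG] \<open>L < real m * r\<close> \<open>m > 0\<close> by (simp add: divide_less_eq mult.commute)
    finally have "dist ?z (\<gamma> (real j / real m) x) < r" .
    moreover have "?z \<in> Mset"
    proof -
      have "x \<noteq> 0" using xG \<open>G \<subseteq> A\<close> \<open>A \<subseteq> Mset\<close> by (auto simp: Mset_def)
      then show ?thesis using norm_mono[OF xG, of "real (Suc j) / real m"] by (auto simp: Mset_def)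
    qed
    ultimately have "?z \<in> nbhd A r - A" using j by (auto simp: nbhd_def)
    then show "x \<in> (\<Union>j<m. E j)" using xG j by (auto simp: E_def)
  qed
  have step: "emeasure (mu \<alpha>) (E j) \<le> emeasure (mu \<alpha>) (nbhd A r - A)" for j
  proof -
    let ?t = "real (Suc j) / real m"
    let ?N = "nbhd A r - A"
    have c: "1 + ?t * \<kappa> \<ge> 1" using \<open>\<kappa> \<ge> 0\<close> by simp
    have "emeasure (mu \<alpha>) (E j) = (\<integral>\<^sup>+x. ennreal (weight \<alpha> x) * indicator (E j) x \<partial>lborel)"
      by (simp add: emeasure_mu)
    also have "\<dots> \<le> (\<integral>\<^sup>+x. ennreal (weight \<alpha> (\<gamma> ?t x)) * indicator ?N (\<gamma> ?t x) \<partial>lborel)"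
      using weight_mono[OF \<open>\<alpha> > 0\<close> norm_mono, of _ ?t]
      by (intro nn_integral_mono) (auto simp: E_def indicator_def intro!: ennreal_leI)
    \<comment> \<open>The inserted factor is the Jacobian of \<open>\<gamma> ?t\<close>. It is at
      least 1, and with it the change of variables becomes exact.\<close>
    also have "\<dots> \<le> ennreal (\<bar>1 + ?t * \<kappa>\<bar> ^ DIM('a)) * \<dots>"
    proof -
      have "1 \<le> ennreal (\<bar>1 + ?t * \<kappa>\<bar> ^ DIM('a))"
        using c by (metis abs_ge_self ennreal_1 ennreal_leI one_le_power order_trans)
      from mult_right_mono[OF this] show ?thesis by simp
    qed
    also have "\<dots> = (\<integral>\<^sup>+x. ennreal (weight \<alpha> x) * indicator ?N x \<partial>lborel)"
      unfolding \<gamma>_affine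
      by (rule nn_integral_lborel_affine[symmetric]) (use c in auto)
    also have "\<dots> = emeasure (mu \<alpha>) ?N" by (simp add: emeasure_mu)
    finally show ?thesis .
  qed
  have "emeasure (mu \<alpha>) {x \<in> G. x + (\<kappa> *\<^sub>R x + h) \<notin> A} \<le> emeasure (mu \<alpha>) (\<Union>j<m. E j)"
    using sub by (intro emeasure_mono) auto
  also have "\<dots> \<le> (\<Sum>j<m. emeasure (mu \<alpha>) (E j))"
    by (intro emeasure_subadditive_finite) auto
  also have "\<dots> \<le> (\<Sum>j<m. emeasure (mu \<alpha>) (nbhd A r - A))"
    by (intro sum_mono step)
  finally show ?thesis by simp
qed

section \<open>Translations\<close>

text \<open>The reflection \<open>h \<mapsto> - h\<close> exchanges two half balls that cover the
  ball.\<close>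

lemma half_ball_volume:
  fixes x :: "'a::euclidean_space"
  shows "emeasure lborel (ball 0 R :: 'a set) \<le> 2 * emeasure lborel {h \<in> ball 0 R. h \<bullet> x \<ge> 0}"
proof -
  let ?H = "{h \<in> ball 0 R. h \<bullet> x \<ge> 0}" and ?H' = "{h \<in> ball 0 R. h \<bullet> x \<le> 0}"
  have [measurable]: "?H \<in> sets borel" "?H' \<in> sets borel" by measurable
  have "emeasure lborel ?H' = (\<integral>\<^sup>+h. indicator ?H' (0 + (-1) *\<^sub>R h) \<partial>lborel)"
    using nn_integral_lborel_affine[of "indicator ?H'" "-1" 0] by simp
  also have "\<dots> = (\<integral>\<^sup>+h. indicator ?H h \<partial>lborel)"
    by (intro nn_integral_cong) (auto simp: indicator_def)
  finally have eq: "emeasure lborel ?H' = emeasure lborel ?H" by simp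
  have "emeasure lborel (ball 0 R :: 'a set) \<le> emeasure lborel (?H \<union> ?H')"
    by (intro emeasure_mono) auto
  also have "\<dots> \<le> emeasure lborel ?H + emeasure lborel ?H'"
    by (intro emeasure_subadditive) auto
  finally show ?thesis unfolding eq mult_2 .
qed

text \<open>Translations by \<open>h\<close>, averaged over \<open>h\<close> in a half ball large enough that \<open>A\<close> cannot fill it.\<close>

lemma outer_bound:
  fixes A :: "'a::euclidean_space set"
  assumes "\<alpha> > 0" and A [measurable]: "A \<in> sets borel" and B [measurable]: "B \<in> sets borel"
    and "A \<subseteq> Mset" "B \<subseteq> A"
    and "R > 0"
    and dense: "\<And>x. x \<in> B \<Longrightarrow>
      4 * emeasure (mu \<alpha>) A \<le> ennreal (weight \<alpha> x) * emeasure lborel (ball 0 R :: 'a set)"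
    and "r > 0" "R < real m * r"
  shows "emeasure (mu \<alpha>) B \<le> 4 * (of_nat m * emeasure (mu \<alpha>) (nbhd A r - A))"
proof -
  let ?b = "emeasure lborel (ball 0 R :: 'a set)"
  have b: "?b \<noteq> \<infinity>" "?b \<noteq> 0"
    using \<open>R > 0\<close> unit_ball_vol_pos[of "real DIM('a)"]
    by (auto simp: emeasure_ball ennreal_eq_0_iff not_le intro!: mult_pos_pos)
  define \<delta> where "\<delta> = of_nat m * emeasure (mu \<alpha>) (nbhd A r - A)"
  \<comment> \<open>\<open>k x h\<close> marks the outward translations that move \<open>x\<close>
    out of \<open>A\<close>. Integrating it over \<open>x\<close> first gives the upper bound
    \<open>fluxes\<close>, over \<open>h\<close> first the lower bound \<open>many\<close>; Fubini
    compares them.\<close>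
  define k :: "'a \<Rightarrow> 'a \<Rightarrow> ennreal" where
    "k x h = (if norm h < R \<and> h \<bullet> x \<ge> 0 \<and> x + h \<notin> A then 1 else 0)" for x h
  have [measurable]: "(\<lambda>(x, h). k x h) \<in> borel_measurable (lborel \<Otimes>\<^sub>M lborel)"
    unfolding k_def by measurable
  have fluxes: "(\<integral>\<^sup>+x. ennreal (weight \<alpha> x) * indicator B x * k x h \<partial>lborel) \<le> indicator (ball 0 R) h * \<delta>"
    for h
  proof (cases "h \<in> ball 0 R")
    case True
    let ?G = "{x \<in> B. h \<bullet> x \<ge> 0}"
    have [measurable]: "?G \<in> sets borel" by measurable
    have "(\<integral>\<^sup>+x. ennreal (weight \<alpha> x) * indicator B x * k x h \<partial>lborel)
        = (\<integral>\<^sup>+x. ennreal (weight \<alpha> x) * indicator {x \<in> ?G. x + (0 *\<^sub>R x + h) \<notin> A} x \<partial>lborel)"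
      using True by (intro nn_integral_cong) (auto simp: k_def indicator_def)
    also have "\<dots> = emeasure (mu \<alpha>) {x \<in> ?G. x + (0 *\<^sub>R x + h) \<notin> A}"
      by (subst emeasure_mu) auto
    also have "\<dots> \<le> \<delta>"
      unfolding \<delta>_def using True assms by (intro flux_bound[where L = R]) auto
    finally show ?thesis using True by simp
  qed (simp add: k_def)
  \<comment> \<open>The half ball has at least half the volume of the ball. The translations in
    \<open>?S\<close> keep \<open>x\<close> in \<open>A\<close> without lowering the density, so
    \<open>?w\<close> times their volume is at most the mass of \<open>A\<close>, hence at most a
    quarter of \<open>?w * ?b\<close>. A quarter of the ball remains for \<open>?F\<close>.\<close>
  have many: "ennreal (weight \<alpha> x) * ?b \<le> 4 * (ennreal (weight \<alpha> x) * (\<integral>\<^sup>+h. k x h \<partial>lborel))"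
    if "x \<in> B" for x
  proof -
    let ?w = "ennreal (weight \<alpha> x)"
    let ?F = "{h \<in> ball 0 R. h \<bullet> x \<ge> 0 \<and> x + h \<notin> A}"
    let ?S = "{h \<in> ball 0 R. h \<bullet> x \<ge> 0 \<and> x + h \<in> A}"
    have [measurable]: "?F \<in> sets borel" "?S \<in> sets borel" by measurable
    have F: "(\<integral>\<^sup>+h. k x h \<partial>lborel) = emeasure lborel ?F"
    proof -
      have "(\<integral>\<^sup>+h. k x h \<partial>lborel) = (\<integral>\<^sup>+h. indicator ?F h \<partial>lborel)"
        by (intro nn_integral_cong) (auto simp: k_def)
      then show ?thesis by simp
    qed
    have "?w * emeasure lborel ?S = (\<integral>\<^sup>+h. ?w * indicator ?S h \<partial>lborel)"
      by (simp add: nn_integral_cmult)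
    also have "\<dots> \<le> (\<integral>\<^sup>+h. ennreal (weight \<alpha> (x + 1 *\<^sub>R h)) * indicator A (x + 1 *\<^sub>R h) \<partial>lborel)"
    proof (intro nn_integral_mono)
      fix h
      have "weight \<alpha> x \<le> weight \<alpha> (x + h)" if "h \<bullet> x \<ge> 0"
        using that by (intro weight_mono \<open>\<alpha> > 0\<close>)
          (simp add: norm_le inner_add_left inner_add_right inner_commute)
      then show "?w * indicator ?S h \<le> ennreal (weight \<alpha> (x + 1 *\<^sub>R h)) * indicator A (x + 1 *\<^sub>R h)"
        by (auto simp: indicator_def intro: ennreal_leI)
    qed
    also have "\<dots> = emeasure (mu \<alpha>) A"
      using nn_integral_lborel_affine[of "\<lambda>y. ennreal (weight \<alpha> y) * indicator A y" 1 x]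
      by (simp add: emeasure_mu)
    finally have "4 * (?w * emeasure lborel ?S) \<le> 4 * emeasure (mu \<alpha>) A"
      by (intro mult_left_mono) auto
    also have "\<dots> \<le> ?w * ?b" by (rule dense[OF that])
    finally have S: "4 * (?w * emeasure lborel ?S) \<le> ?w * ?b" .
    have "?b \<le> 2 * emeasure lborel {h \<in> ball 0 R. h \<bullet> x \<ge> 0}" by (rule half_ball_volume)
    also have "\<dots> \<le> 2 * (emeasure lborel ?F + emeasure lborel ?S)"
      by (intro mult_left_mono order_trans[OF emeasure_mono emeasure_subadditive]) auto
    finally have "2 * (?w * ?b) \<le> 2 * (?w * (2 * (emeasure lborel ?F + emeasure lborel ?S)))"
      by (intro mult_left_mono) auto
    also have "\<dots> = 4 * (?w * emeasure lborel ?F) + 4 * (?w * emeasure lborel ?S)"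
      by (simp add: distrib_left mult.assoc[symmetric] mult.commute)
    also have "\<dots> \<le> 4 * (?w * emeasure lborel ?F) + ?w * ?b"
      using S by (intro add_left_mono)
    finally have "?w * ?b + ?w * ?b \<le> ?w * ?b + 4 * (?w * emeasure lborel ?F)"
      by (simp add: mult_2 add.commute)
    \<comment> \<open>Finiteness allows one copy of \<open>?w * ?b\<close> to be cancelled on both
      sides.\<close>
    moreover have "?w * ?b \<noteq> \<infinity>" using b by (simp add: ennreal_mult_eq_top_iff)
    ultimately show ?thesis by (simp add: F)
  qed
  have "emeasure (mu \<alpha>) B * ?b = (\<integral>\<^sup>+x. ennreal (weight \<alpha> x) * indicator B x * ?b \<partial>lborel)"
    by (simp add: emeasure_mu nn_integral_multc)
  also have "\<dots> \<le> (\<integral>\<^sup>+x. 4 * (\<integral>\<^sup>+h. ennreal (weight \<alpha> x) * indicator B x * k x h \<partial>lborel) \<partial>lborel)"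
  proof (intro nn_integral_mono)
    fix x
    have [measurable]: "k x \<in> borel_measurable borel" unfolding k_def by measurable
    show "ennreal (weight \<alpha> x) * indicator B x * ?b
        \<le> 4 * (\<integral>\<^sup>+h. ennreal (weight \<alpha> x) * indicator B x * k x h \<partial>lborel)"
      using many[of x] by (cases "x \<in> B") (simp_all add: nn_integral_cmult)
  qed
  also have "\<dots> = 4 * (\<integral>\<^sup>+x. (\<integral>\<^sup>+h. ennreal (weight \<alpha> x) * indicator B x * k x h \<partial>lborel) \<partial>lborel)"
    by (subst nn_integral_cmult) auto
  also have "\<dots> = 4 * (\<integral>\<^sup>+h. (\<integral>\<^sup>+x. ennreal (weight \<alpha> x) * indicator B x * k x h \<partial>lborel) \<partial>lborel)"
    by (subst lborel_pair.Fubini') auto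
  also have "\<dots> \<le> 4 * (\<integral>\<^sup>+h. indicator (ball 0 R :: 'a set) h * \<delta> \<partial>lborel)"
    by (intro mult_left_mono nn_integral_mono fluxes) auto
  also have "\<dots> = 4 * \<delta> * ?b"
    by (subst nn_integral_multc) (simp_all add: mult_ac borel_measurable_indicator)
  finally have "?b * emeasure (mu \<alpha>) B \<le> ?b * (4 * \<delta>)" by (simp add: mult.commute)
  then show ?thesis
    using b by (simp add: ennreal_mult_le_mult_iff \<delta>_def)
qed

section \<open>Dilations\<close>

text \<open>Points of \<open>B\<close> whose dilated image is still in \<open>A\<close> are
  controlled by the change of variables: \<open>ratio\<close> bounds their mass by \<open>q\<close>
  times that of \<open>A\<close>. The others leave \<open>A\<close>, and \<open>flux_bound\<close>
  with \<open>h = 0\<close> applies to them.\<close>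

lemma inner_bound:
  fixes A :: "'a::euclidean_space set"
  assumes "\<alpha> > 0" and A [measurable]: "A \<in> sets borel" and B [measurable]: "B \<in> sets borel"
    and "A \<subseteq> Mset" "B \<subseteq> A" "\<kappa> > 0" "q \<ge> 0"
    and small: "\<And>x. x \<in> B \<Longrightarrow> norm x \<le> \<rho>"
    and ratio: "\<And>x. x \<in> B \<Longrightarrow> weight \<alpha> x \<le> q * (1 + \<kappa>) ^ DIM('a) * weight \<alpha> ((1 + \<kappa>) *\<^sub>R x)"
    and "r > 0" "\<kappa> * \<rho> < real m * r"
  shows "emeasure (mu \<alpha>) B
    \<le> ennreal q * emeasure (mu \<alpha>) A + of_nat m * emeasure (mu \<alpha>) (nbhd A r - A)"
proof -
  \<comment> \<open>The summand 0 is the vector \<open>h\<close> in the shape required by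
    \<open>flux_bound\<close>.\<close>
  let ?T = "{x \<in> B. x + (\<kappa> *\<^sub>R x + 0) \<in> A}" and ?F = "{x \<in> B. x + (\<kappa> *\<^sub>R x + 0) \<notin> A}"
  have [measurable]: "?T \<in> sets borel" "?F \<in> sets borel" by measurable
  have split: "emeasure (mu \<alpha>) B \<le> emeasure (mu \<alpha>) ?T + emeasure (mu \<alpha>) ?F"
    by (intro order_trans[OF emeasure_mono emeasure_subadditive]) auto
  have F: "emeasure (mu \<alpha>) ?F \<le> of_nat m * emeasure (mu \<alpha>) (nbhd A r - A)"
    using assms by (intro flux_bound[where L = "\<kappa> * \<rho>"]) auto
  have T: "emeasure (mu \<alpha>) ?T \<le> ennreal q * emeasure (mu \<alpha>) A"
  proof -
    let ?c = "1 + \<kappa>"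
    have "emeasure (mu \<alpha>) ?T = (\<integral>\<^sup>+x. ennreal (weight \<alpha> x) * indicator ?T x \<partial>lborel)"
      by (subst emeasure_mu) auto
    also have "\<dots> \<le> (\<integral>\<^sup>+x. ennreal (q * ?c ^ DIM('a)) *
        (ennreal (weight \<alpha> (0 + ?c *\<^sub>R x)) * indicator A (0 + ?c *\<^sub>R x)) \<partial>lborel)"
    proof (intro nn_integral_mono)
      fix x
      have "ennreal (weight \<alpha> x) \<le> ennreal (q * ?c ^ DIM('a)) * ennreal (weight \<alpha> (?c *\<^sub>R x))"
        if "x \<in> B"
        using ratio[OF that] \<open>q \<ge> 0\<close> \<open>\<kappa> > 0\<close> by (simp add: ennreal_mult[symmetric] ennreal_leI)
      then show "ennreal (weight \<alpha> x) * indicator ?T x \<le> ennreal (q * ?c ^ DIM('a)) *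
          (ennreal (weight \<alpha> (0 + ?c *\<^sub>R x)) * indicator A (0 + ?c *\<^sub>R x))"
        by (auto simp: indicator_def scaleR_left_distrib)
    qed
    also have "\<dots> = ennreal q * (ennreal (\<bar>?c\<bar> ^ DIM('a)) *
        (\<integral>\<^sup>+x. ennreal (weight \<alpha> (0 + ?c *\<^sub>R x)) * indicator A (0 + ?c *\<^sub>R x) \<partial>lborel))"
      using \<open>q \<ge> 0\<close> \<open>\<kappa> > 0\<close> by (subst nn_integral_cmult) (auto simp: ennreal_mult mult.assoc)
    also have "\<dots> = ennreal q * emeasure (mu \<alpha>) A"
      using \<open>\<kappa> > 0\<close> by (subst nn_integral_lborel_affine[symmetric]) (auto simp: emeasure_mu)
    finally show ?thesis .
  qed
  show ?thesis by (rule order_trans[OF split add_mono[OF T F]])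
qed

section \<open>From flux bounds to the perimeter\<close>

text \<open>Taking the least \<open>m\<close> with \<open>L < m r\<close> gives
  \<open>m r \<le> L + r \<le> 2 L\<close> once \<open>r < L\<close>, so the mass of the shell
  divided by \<open>r\<close> is at least \<open>u / (m r) \<ge> u / (2 L)\<close>.\<close>

lemma perimeter_ge:
  fixes A :: "'a::euclidean_space set"
  assumes A [measurable]: "A \<in> sets borel" and "A \<subseteq> Mset" and fin: "emeasure (mu \<alpha>) A < \<infinity>"
    and "L > 0" "u \<ge> 0"
    and bound: "\<And>r m. r > 0 \<Longrightarrow> L < real m * r \<Longrightarrow>
      ennreal u \<le> of_nat m * emeasure (mu \<alpha>) (nbhd A r - A)"
  shows "ereal (u / (2 * L)) \<le> perimeter \<alpha> A"
proof -
  have "ereal (u / (2 * L)) \<le> (enn2ereal (emeasure (mu \<alpha>) (nbhd A r)) - enn2ereal (emeasure (mu \<alpha>) A)) / ereal r"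
    if r: "0 < r" "r < L" for r
  proof -
    let ?N = "nbhd A r - A"
    define m where "m = nat \<lfloor>L / r\<rfloor> + 1"
    have m: "real m \<le> L / r + 1" "L / r < real m"
      using r unfolding m_def by (auto simp: less_floor_iff) linarith+
    have "L < real m * r" using m(2) r by (simp add: divide_less_eq)
    have "real m * r \<le> 2 * L"
    proof -
      have "real m * r \<le> (L / r + 1) * r" using m r by (intro mult_right_mono) auto
      also have "\<dots> = L + r" using r by (simp add: field_simps)
      finally show ?thesis using r by simp
    qed
    have "A \<subseteq> nbhd A r" using \<open>A \<subseteq> Mset\<close> r by (force simp: nbhd_def)
    then have "nbhd A r = A \<union> ?N" by auto
    then have "emeasure (mu \<alpha>) (nbhd A r) = emeasure (mu \<alpha>) A + emeasure (mu \<alpha>) ?N"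
      using plus_emeasure[of A "mu \<alpha>" ?N] by simp
    \<comment> \<open>Since the mass of \<open>A\<close> is finite, the extended real difference is
      the mass of the shell, even when the latter is infinite.\<close>
    moreover have "\<bar>enn2ereal (emeasure (mu \<alpha>) A)\<bar> \<noteq> \<infinity>"
      using fin by (cases "emeasure (mu \<alpha>) A") auto
    ultimately have diff: "enn2ereal (emeasure (mu \<alpha>) (nbhd A r)) - enn2ereal (emeasure (mu \<alpha>) A)
        = enn2ereal (emeasure (mu \<alpha>) ?N)"
      by (cases "enn2ereal (emeasure (mu \<alpha>) A)"; cases "enn2ereal (emeasure (mu \<alpha>) ?N)")
         (auto simp: plus_ennreal.rep_eq)
    have main: "ennreal u \<le> of_nat m * emeasure (mu \<alpha>) ?N"
      using bound[OF r(1) \<open>L < real m * r\<close>] .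
    show ?thesis
    proof (cases "emeasure (mu \<alpha>) ?N")
      case (real d)
      then have "ennreal u \<le> ennreal (real m * d)"
        using main by (simp add: ennreal_mult ennreal_of_nat_eq_real_of_nat)
      then have "u \<le> real m * d" using real by (simp add: ennreal_le_iff)
      then have "u * r \<le> (real m * r) * d" using r by (simp add: mult_right_mono mult.commute mult.left_commute)
      also have "\<dots> \<le> 2 * L * d" using real \<open>real m * r \<le> 2 * L\<close> by (intro mult_right_mono) auto
      finally have "u / (2 * L) \<le> d / r" using r \<open>L > 0\<close> by (simp add: field_simps)
      then show ?thesis unfolding diff using real r by simp
    next
      case top
      then show ?thesis unfolding diff using r by simp
    qed
  qed
  then have "\<forall>\<^sub>F r in at_right 0. ereal (u / (2 * L)) \<le>
      (enn2ereal (emeasure (mu \<alpha>) (nbhd A r)) - enn2ereal (emeasure (mu \<alpha>) A)) / ereal r"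
    unfolding eventually_at_right_field using \<open>L > 0\<close> by blast
  then show ?thesis unfolding perimeter_def by (rule Liminf_bounded)
qed

text \<open>At least half of the mass of \<open>A\<close> lies outside or inside the ball of radius
  \<rho>. Translations handle the first case and dilations with \<open>q = 1/4\<close> the
  second.\<close>

lemma perimeter_dichotomy:
  fixes A :: "'a::euclidean_space set"
  assumes "\<alpha> > 0" and A [measurable]: "A \<in> sets borel" and "A \<subseteq> Mset"
    and fin: "emeasure (mu \<alpha>) A < \<infinity>"
    and "R > 0" "\<kappa> > 0" "\<rho> > 0" "w \<ge> 0"
    and heavy: "\<And>x::'a. \<rho> \<le> norm x \<Longrightarrow> w \<le> weight \<alpha> x"
    and room: "4 * measure (mu \<alpha>) A \<le> w * (unit_ball_vol (real DIM('a)) * R ^ DIM('a))"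
    and ratio: "\<And>x::'a. x \<noteq> 0 \<Longrightarrow> norm x < \<rho> \<Longrightarrow>
      weight \<alpha> x \<le> 1/4 * (1 + \<kappa>) ^ DIM('a) * weight \<alpha> ((1 + \<kappa>) *\<^sub>R x)"
  shows "ereal (min (measure (mu \<alpha>) A / (16 * R)) (measure (mu \<alpha>) A / (8 * (\<kappa> * \<rho>))))
    \<le> perimeter \<alpha> A"
proof -
  define v where "v = measure (mu \<alpha>) A"
  have "v \<ge> 0" by (simp add: v_def)
  have v: "emeasure (mu \<alpha>) A = ennreal v"
    using fin by (simp add: v_def emeasure_eq_ennreal_measure less_top)
  let ?O = "A - ball 0 \<rho>" and ?I = "A \<inter> ball 0 \<rho>"
  have "v = measure (mu \<alpha>) (?O \<union> ?I)"
    unfolding v_def by (rule arg_cong[where f = "measure (mu \<alpha>)"]) auto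
  also have "\<dots> \<le> measure (mu \<alpha>) ?O + measure (mu \<alpha>) ?I"
    by (rule measure_Un_le) simp_all
  finally consider (outer) "v / 2 \<le> measure (mu \<alpha>) ?O" | (inner) "v / 2 \<le> measure (mu \<alpha>) ?I"
    by linarith
  then show ?thesis
  proof cases
    case outer
    \<comment> \<open>Here \<open>v / 2\<close> is at most 4 times the flux, which gives
      \<open>u = v / 8\<close>.\<close>
    have "ereal (v / 8 / (2 * R)) \<le> perimeter \<alpha> A"
    proof (rule perimeter_ge)
      fix r :: real and m :: nat assume r: "r > 0" "R < real m * r"
      have "4 * ennreal (v / 8) = ennreal (v / 2)"
        using \<open>v \<ge> 0\<close> by (simp add: ennreal_mult[symmetric] flip: ennreal_numeral)
      also have "\<dots> \<le> ennreal (measure (mu \<alpha>) ?O)" by (rule ennreal_leI[OF outer])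
      also have "\<dots> \<le> emeasure (mu \<alpha>) ?O" by (simp add: measure_def ennreal_enn2real_if)
      also have "\<dots> \<le> 4 * (of_nat m * emeasure (mu \<alpha>) (nbhd A r - A))"
      proof (rule outer_bound[where R = R])
        fix x assume x: "x \<in> ?O"
        have "4 * emeasure (mu \<alpha>) A = ennreal (4 * v)"
          using \<open>v \<ge> 0\<close> by (simp add: v ennreal_mult)
        also have "\<dots> \<le> ennreal (weight \<alpha> x * (unit_ball_vol (real DIM('a)) * R ^ DIM('a)))"
          using x \<open>R > 0\<close> room by (intro ennreal_leI order_trans[OF room[folded v_def] mult_right_mono] heavy) auto
        also have "\<dots> = ennreal (weight \<alpha> x) * emeasure lborel (ball 0 R :: 'a set)"
          using \<open>R > 0\<close> by (simp add: ennreal_mult emeasure_ball)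
        finally show "4 * emeasure (mu \<alpha>) A \<le> ennreal (weight \<alpha> x) * emeasure lborel (ball 0 R :: 'a set)" .
      qed (use assms r in auto)
      finally show "ennreal (v / 8) \<le> of_nat m * emeasure (mu \<alpha>) (nbhd A r - A)"
        by (subst (asm) ennreal_mult_le_mult_iff) auto
    qed (use assms \<open>v \<ge> 0\<close> in auto)
    then show ?thesis
      by (rule order_trans[rotated]) (simp add: v_def)
  next
    case inner
    \<comment> \<open>Here \<open>v / 2\<close> is at most \<open>v / 4\<close> plus the flux, which
      gives \<open>u = v / 4\<close>.\<close>
    have "ereal (v / 4 / (2 * (\<kappa> * \<rho>))) \<le> perimeter \<alpha> A"
    proof (rule perimeter_ge)
      fix r :: real and m :: nat assume r: "r > 0" "\<kappa> * \<rho> < real m * r"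
      have "ennreal (v / 4) + ennreal (v / 4) = ennreal (v / 2)"
        using \<open>v \<ge> 0\<close> by (simp add: ennreal_plus[symmetric] del: ennreal_plus)
      also have "\<dots> \<le> ennreal (measure (mu \<alpha>) ?I)" by (rule ennreal_leI[OF inner])
      also have "\<dots> \<le> emeasure (mu \<alpha>) ?I" by (simp add: measure_def ennreal_enn2real_if)
      also have "\<dots> \<le> ennreal (1/4) * emeasure (mu \<alpha>) A + of_nat m * emeasure (mu \<alpha>) (nbhd A r - A)"
        using \<open>A \<subseteq> Mset\<close> assms r
        by (intro inner_bound[where \<kappa> = \<kappa> and \<rho> = \<rho>] ratio) (auto simp: Mset_def)
      also have "ennreal (1/4) * emeasure (mu \<alpha>) A = ennreal (v / 4)"
        using \<open>v \<ge> 0\<close> by (simp add: v ennreal_mult[symmetric])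
      finally show "ennreal (v / 4) \<le> of_nat m * emeasure (mu \<alpha>) (nbhd A r - A)"
        by simp
    qed (use assms \<open>v \<ge> 0\<close> in auto)
    then show ?thesis
      by (rule order_trans[rotated]) (simp add: v_def)
  qed
qed

section \<open>Choice of parameters for small and for large volume\<close>

text \<open>The rate comes from the dilations, where \<open>1 / (\<kappa> \<rho>)\<close> is a
  constant times \<open>l powr (1 + 1 / \<alpha>)\<close>. The translations give
  \<open>1 / R\<close>, which is exponential in \<open>l\<close> and therefore larger for large
  \<open>l\<close>, up to a constant.\<close>

lemma perimeter_small_volume:
  fixes \<alpha> :: real
  assumes "\<alpha> > 0"
  obtains C \<tau> where "C > 0" "0 < \<tau>" "\<tau> < 1"
    "\<And>A :: 'a::euclidean_space set. A \<in> sets borel \<Longrightarrow> A \<subseteq> Mset \<Longrightarrow> emeasure (mu \<alpha>) A < \<infinity> \<Longrightarrow>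
      0 < measure (mu \<alpha>) A \<Longrightarrow> measure (mu \<alpha>) A \<le> \<tau> \<Longrightarrow>
      ereal (C * (measure (mu \<alpha>) A * ln (1 / measure (mu \<alpha>) A) powr (1 + 1 / \<alpha>))) \<le> perimeter \<alpha> A"
proof -
  define n where "n = DIM('a)"
  have "n > 0" by (simp add: n_def)
  define \<omega> where "\<omega> = unit_ball_vol (real n)"
  have "\<omega> > 0" by (simp add: \<omega>_def)
  \<comment> \<open>Any \<open>b\<close> with \<open>\<alpha> * b / 2 > ln 4\<close> would do; this
    one makes the left side 3.\<close>
  define b where "b = 6 / \<alpha>"
  have "b > 0" using assms by (simp add: b_def)
  define K where "K = (4 / \<omega>) powr (1 / real n)"
  have "K > 0" using \<open>\<omega> > 0\<close> by (simp add: K_def)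
  have Kn: "K ^ n = 4 / \<omega>"
    using \<open>\<omega> > 0\<close> \<open>n > 0\<close> by (simp add: K_def powr_powr flip: powr_realpow)
  \<comment> \<open>The function is the growth of the logarithm of the density on the sphere of
    radius \<rho> under dilation by \<open>1 + b / l\<close>. A growth above \<open>ln 4\<close>
    yields the factor 4.\<close>
  have "((\<lambda>l. l / 2 * (1 - (1 + b / l) powr - \<alpha>)) \<longlongrightarrow> \<alpha> * b / 2) at_top"
    using assms \<open>b > 0\<close> by real_asymp
  moreover have "ln 4 < \<alpha> * b / 2"
    using assms ln_2_less_1 ln_realpow[of 2 2] by (simp add: b_def)
  ultimately have "\<forall>\<^sub>F l in at_top. ln 4 < l / 2 * (1 - (1 + b / l) powr - \<alpha>)"
    by (rule order_tendstoD)
  moreover have "\<forall>\<^sub>F l in at_top. l powr (1 + 1 / \<alpha>) \<le> exp (l / (2 * real n))"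
    using assms \<open>n > 0\<close> by real_asymp
  ultimately have "\<forall>\<^sub>F l in at_top. ln 4 < l / 2 * (1 - (1 + b / l) powr - \<alpha>) \<and>
      l powr (1 + 1 / \<alpha>) \<le> exp (l / (2 * real n))"
    by (rule eventually_conj)
  then obtain l0 where l0: "\<And>l. l \<ge> l0 \<Longrightarrow> ln 4 < l / 2 * (1 - (1 + b / l) powr - \<alpha>)"
      "\<And>l. l \<ge> l0 \<Longrightarrow> l powr (1 + 1 / \<alpha>) \<le> exp (l / (2 * real n))"
    unfolding eventually_at_top_linorder by blast
  \<comment> \<open>Thus \<open>v \<le> \<tau>\<close> means that \<open>l\<close> is at least
    \<open>l0\<close> and at least 1.\<close>
  define \<tau> where "\<tau> = exp (- max l0 1)"
  define C where "C = min (1 / (16 * K)) (1 / (8 * b * 2 powr (1 / \<alpha>)))"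
  show thesis
  proof (rule that)
    show "C > 0" using \<open>K > 0\<close> \<open>b > 0\<close> by (simp add: C_def)
    show "0 < \<tau>" "\<tau> < 1" by (auto simp: \<tau>_def)
    fix A :: "'a set"
    assume A: "A \<in> sets borel" "A \<subseteq> Mset" "emeasure (mu \<alpha>) A < \<infinity>"
      and v0: "0 < measure (mu \<alpha>) A" and v\<tau>: "measure (mu \<alpha>) A \<le> \<tau>"
    define v where "v = measure (mu \<alpha>) A"
    define l where "l = ln (1 / v)"
    have v: "v = exp (- l)" using v0 by (simp add: l_def v_def ln_div)
    then have l: "l \<ge> l0" "l \<ge> 1" using v\<tau> by (auto simp: v_def[symmetric] \<tau>_def)
    define \<kappa> where "\<kappa> = b / l"
    have "\<kappa> > 0" using l \<open>b > 0\<close> by (simp add: \<kappa>_def)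
    define \<rho> where "\<rho> = (2 / l) powr (1 / \<alpha>)"
    have "\<rho> > 0" using l by (simp add: \<rho>_def)
    have \<rho>\<alpha>: "\<rho> powr \<alpha> = 2 / l" using l assms by (simp add: \<rho>_def powr_powr)
    define R where "R = K * exp (- l / (2 * real n))"
    have "R > 0" using \<open>K > 0\<close> by (simp add: R_def)
    have "R ^ n = 4 / \<omega> * exp (- l / 2)"
      using \<open>n > 0\<close> by (simp add: R_def power_mult_distrib Kn flip: exp_of_nat_mult)
    \<comment> \<open>\<open>K\<close> was chosen to make this an equality.\<close>
    then have room: "4 * v = exp (- l / 2) * (\<omega> * R ^ n)"
      using \<open>\<omega> > 0\<close> by (simp add: v flip: exp_add)
    have "ereal (min (v / (16 * R)) (v / (8 * (\<kappa> * \<rho>)))) \<le> perimeter \<alpha> A"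
      unfolding v_def
    proof (rule perimeter_dichotomy[OF assms A \<open>R > 0\<close> \<open>\<kappa> > 0\<close> \<open>\<rho> > 0\<close>])
      show "4 * measure (mu \<alpha>) A \<le> exp (- l / 2) * (unit_ball_vol (real DIM('a)) * R ^ DIM('a))"
        using room by (simp add: v_def \<omega>_def n_def)
    next
      fix x :: 'a assume "\<rho> \<le> norm x"
      then have "\<rho> powr \<alpha> \<le> norm x powr \<alpha>"
        using \<open>\<rho> > 0\<close> assms by (intro powr_mono2) auto
      moreover have "0 < \<rho> powr \<alpha>" using \<open>\<rho> > 0\<close> by simp
      ultimately have "1 / (norm x powr \<alpha>) \<le> 1 / (2 / l)"
        unfolding \<rho>\<alpha>[symmetric] by (intro divide_left_mono mult_pos_pos) auto
      then show "exp (- l / 2) \<le> weight \<alpha> x"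
        using \<open>\<rho> \<le> norm x\<close> \<open>\<rho> > 0\<close> by (subst weight_eq) auto
    next
      fix x :: 'a assume x: "x \<noteq> 0" "norm x < \<rho>"
      define s where "s = 1 / (norm x powr \<alpha>)"
      have "norm x powr \<alpha> \<le> 2 / l"
        using x assms unfolding \<rho>\<alpha>[symmetric] by (intro powr_mono2) auto
      then have s: "s \<ge> l / 2"
        using x l by (simp add: s_def field_simps)
      \<comment> \<open>Dilation multiplies the exponent \<open>s\<close> by \<open>c\<close>. The
        decrease \<open>s * (1 - c)\<close> grows with \<open>s\<close>, so its value at
        \<open>s = l / 2\<close>, on the sphere of radius \<rho>, is the worst case inside the
        ball.\<close>
      define c where "c = (1 + \<kappa>) powr - \<alpha>"
      have "c \<le> 1" unfolding c_def using \<open>\<kappa> > 0\<close> assms by (simp add: powr_minus_divide ge_one_powr_ge_zero)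
      have "ln 4 \<le> l / 2 * (1 - c)"
        using l0(1)[OF l(1)] by (simp add: c_def \<kappa>_def)
      also have "\<dots> \<le> s * (1 - c)" using s \<open>c \<le> 1\<close> by (intro mult_right_mono) auto
      finally have "exp (- s) \<le> exp (- s * c - ln 4)"
        by (simp add: algebra_simps)
      also have "\<dots> = 1/4 * exp (- s * c)" by (simp add: exp_diff)
      also have "\<dots> \<le> 1/4 * (1 + \<kappa>) ^ DIM('a) * exp (- s * c)"
        using \<open>\<kappa> > 0\<close> by (simp add: one_le_power)
      finally have "exp (- s) \<le> 1/4 * (1 + \<kappa>) ^ DIM('a) * exp (- s * c)" .
      moreover have "weight \<alpha> x = exp (- s)" using x by (simp add: weight_eq s_def)
      moreover have "weight \<alpha> ((1 + \<kappa>) *\<^sub>R x) = exp (- s * c)"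
        using x \<open>\<kappa> > 0\<close>
        by (simp add: weight_eq s_def c_def powr_mult powr_minus_divide mult.commute)
      ultimately show "weight \<alpha> x \<le> 1/4 * (1 + \<kappa>) ^ DIM('a) * weight \<alpha> ((1 + \<kappa>) *\<^sub>R x)"
        by simp
    qed simp
    moreover have "C * (v * l powr (1 + 1 / \<alpha>)) \<le> v / (16 * R)"
    proof -
      have "C * (v * l powr (1 + 1 / \<alpha>)) \<le> 1 / (16 * K) * (v * exp (l / (2 * real n)))"
        using l0(2)[OF l(1)] \<open>K > 0\<close> \<open>b > 0\<close> by (intro mult_mono) (auto simp: C_def v)
      also have "\<dots> = v / (16 * R)" by (simp add: R_def exp_minus field_simps)
      finally show ?thesis .
    qed
    moreover have "C * (v * l powr (1 + 1 / \<alpha>)) \<le> v / (8 * (\<kappa> * \<rho>))"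
    proof -
      have "C * (v * l powr (1 + 1 / \<alpha>)) \<le> 1 / (8 * b * 2 powr (1 / \<alpha>)) * (v * l powr (1 + 1 / \<alpha>))"
        by (intro mult_right_mono) (auto simp: C_def v)
      also have "\<dots> = v / (8 * (\<kappa> * \<rho>))"
        using l by (simp add: \<kappa>_def \<rho>_def powr_add powr_divide)
      finally show ?thesis .
    qed
    ultimately have "ereal (C * (v * l powr (1 + 1 / \<alpha>))) \<le> perimeter \<alpha> A"
      by (meson ereal_less_eq(3) min.boundedI order_trans)
    then show "ereal (C * (measure (mu \<alpha>) A * ln (1 / measure (mu \<alpha>) A) powr (1 + 1 / \<alpha>))) \<le> perimeter \<alpha> A"
      by (simp only: v_def l_def)
  qed
qed

text \<open>Outside the unit ball the density is at least \<open>exp (- 1)\<close>, so translations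
  of length \<open>K * p\<close> with \<open>p = v powr (1 / n)\<close> give the Euclidean rate
  \<open>v / p\<close>. Dilations give \<open>v / 24\<close>, which is comparable or better because
  \<open>p\<close> is bounded below in terms of \<tau>.\<close>

lemma perimeter_large_volume:
  fixes \<alpha> \<tau> :: real
  assumes "\<alpha> > 0" "\<tau> > 0"
  obtains C where "C > 0"
    "\<And>A :: 'a::euclidean_space set. A \<in> sets borel \<Longrightarrow> A \<subseteq> Mset \<Longrightarrow> emeasure (mu \<alpha>) A < \<infinity> \<Longrightarrow>
      \<tau> < measure (mu \<alpha>) A \<Longrightarrow>
      ereal (C * measure (mu \<alpha>) A powr ((real DIM('a) - 1) / real DIM('a))) \<le> perimeter \<alpha> A"
proof -
  define n where "n = DIM('a)"
  have "n > 0" by (simp add: n_def)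
  define \<omega> where "\<omega> = unit_ball_vol (real n)"
  have "\<omega> > 0" by (simp add: \<omega>_def)
  define K where "K = (4 * exp 1 / \<omega>) powr (1 / real n)"
  have "K > 0" using \<open>\<omega> > 0\<close> by (simp add: K_def)
  have Kn: "K ^ n = 4 * exp 1 / \<omega>"
    using \<open>\<omega> > 0\<close> \<open>n > 0\<close> by (simp add: K_def powr_powr flip: powr_realpow)
  define C where "C = min (1 / (16 * K)) (\<tau> powr (1 / real n) / 24)"
  show thesis
  proof (rule that)
    show "C > 0" using \<open>K > 0\<close> assms by (simp add: C_def)
    fix A :: "'a set"
    assume A: "A \<in> sets borel" "A \<subseteq> Mset" "emeasure (mu \<alpha>) A < \<infinity>"
      and v\<tau>: "\<tau> < measure (mu \<alpha>) A"
    define v where "v = measure (mu \<alpha>) A"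
    have v: "v > \<tau>" "v > 0" using v\<tau> assms by (auto simp: v_def)
    define p where "p = v powr (1 / real n)"
    have "p > 0" using v by (simp add: p_def)
    have pn: "p ^ n = v" using v \<open>n > 0\<close> by (simp add: p_def powr_powr flip: powr_realpow)
    have split: "v powr ((real n - 1) / real n) = v / p"
      using v \<open>n > 0\<close> by (simp add: p_def diff_divide_distrib powr_diff)
    have "exp (- 1) * (\<omega> * (K * p) ^ n) = 4 * v * (exp (- 1) * exp 1)"
      using \<open>\<omega> > 0\<close> by (simp add: power_mult_distrib Kn pn)
    then have room: "exp (- 1) * (\<omega> * (K * p) ^ n) = 4 * v"
      by (simp flip: exp_add)
    have "ereal (min (v / (16 * (K * p))) (v / (8 * (3 * 1)))) \<le> perimeter \<alpha> A"
      unfolding v_def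
    proof (rule perimeter_dichotomy[OF assms(1) A])
      show "4 * measure (mu \<alpha>) A \<le> exp (- 1) * (unit_ball_vol (real DIM('a)) * (K * p) ^ DIM('a))"
        using room by (simp flip: v_def \<omega>_def n_def)
    next
      fix x :: 'a assume "1 \<le> norm x"
      then have "1 \<le> norm x powr \<alpha>" using assms by (simp add: ge_one_powr_ge_zero)
      moreover have "x \<noteq> 0" using \<open>1 \<le> norm x\<close> by auto
      ultimately show "exp (- 1) \<le> weight \<alpha> x" by (simp add: weight_eq)
    next
      fix x :: 'a
      \<comment> \<open>Monotonicity of the density suffices: with \<open>\<kappa> = 3\<close> the
        volume factor \<open>4 ^ n\<close> alone is at least 4.\<close>
      have "weight \<alpha> x \<le> 1 * weight \<alpha> ((1 + 3) *\<^sub>R x)"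
        using weight_mono[OF assms(1), of x "4 *\<^sub>R x"] by simp
      also have "\<dots> \<le> 1/4 * (1 + 3) ^ DIM('a) * weight \<alpha> ((1 + 3) *\<^sub>R x)"
        using self_le_power[of "4::real" "DIM('a)"] by (intro mult_right_mono) auto
      finally show "weight \<alpha> x \<le> 1/4 * (1 + 3) ^ DIM('a) * weight \<alpha> ((1 + 3) *\<^sub>R x)" .
    qed (use \<open>K > 0\<close> \<open>p > 0\<close> in auto)
    moreover have "C * (v / p) \<le> v / (16 * (K * p))"
    proof -
      have "C * (v / p) \<le> 1 / (16 * K) * (v / p)"
        using v \<open>p > 0\<close> by (intro mult_right_mono) (auto simp: C_def)
      then show ?thesis by simp
    qed
    moreover have "C * (v / p) \<le> v / (8 * (3 * 1))"
    proof -
      have "\<tau> powr (1 / real n) \<le> p"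
        unfolding p_def using v assms by (intro powr_mono2) auto
      then have "C \<le> p / 24" by (simp add: C_def min_le_iff_disj)
      then have "C * (v / p) \<le> p / 24 * (v / p)"
        using v \<open>p > 0\<close> by (intro mult_right_mono) auto
      then show ?thesis using \<open>p > 0\<close> by simp
    qed
    ultimately have "ereal (C * (v / p)) \<le> perimeter \<alpha> A"
      by (meson ereal_less_eq(3) min.boundedI order_trans)
    then show "ereal (C * measure (mu \<alpha>) A powr ((real DIM('a) - 1) / real DIM('a))) \<le> perimeter \<alpha> A"
      by (simp only: v_def[symmetric] n_def[symmetric] split)
  qed
qed

section \<open>Joining the two regimes\<close>

theorem theorem5p3:
  fixes \<alpha> :: real
  assumes "\<alpha> > 0"
  shows "\<exists>C>0. \<exists>\<tau>. 0 < \<tau> \<and> \<tau> < 1 \<and>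
    (\<forall>A :: 'a::euclidean_space set. A \<in> sets borel \<longrightarrow> A \<subseteq> Mset \<longrightarrow>
        emeasure (mu \<alpha>) A < \<infinity> \<longrightarrow>
        perimeter \<alpha> A \<ge> ereal (Itilde C \<tau> \<alpha> DIM('a) (measure (mu \<alpha>) A)))"
proof -
  obtain C1 \<tau> where C1: "C1 > 0" and \<tau>: "0 < \<tau>" "\<tau> < 1"
    and small: "\<And>A :: 'a set. A \<in> sets borel \<Longrightarrow> A \<subseteq> Mset \<Longrightarrow> emeasure (mu \<alpha>) A < \<infinity> \<Longrightarrow>
      0 < measure (mu \<alpha>) A \<Longrightarrow> measure (mu \<alpha>) A \<le> \<tau> \<Longrightarrow>
      ereal (C1 * (measure (mu \<alpha>) A * ln (1 / measure (mu \<alpha>) A) powr (1 + 1 / \<alpha>))) \<le> perimeter \<alpha> A"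
    using perimeter_small_volume[OF assms] by metis
  obtain C2 where C2: "C2 > 0"
    and large: "\<And>A :: 'a set. A \<in> sets borel \<Longrightarrow> A \<subseteq> Mset \<Longrightarrow> emeasure (mu \<alpha>) A < \<infinity> \<Longrightarrow>
      \<tau> < measure (mu \<alpha>) A \<Longrightarrow>
      ereal (C2 * measure (mu \<alpha>) A powr ((real DIM('a) - 1) / real DIM('a))) \<le> perimeter \<alpha> A"
    using perimeter_large_volume[OF assms \<tau>(1)] by metis
  \<comment> \<open>The threshold \<tau> is fixed by the small volumes and then passed to the large
    ones, so only the constants have to be reconciled.\<close>
  define C where "C = min C1 C2"
  have "ereal (Itilde C \<tau> \<alpha> DIM('a) (measure (mu \<alpha>) A)) \<le> perimeter \<alpha> A"
    if A: "A \<in> sets borel" "A \<subseteq> Mset" "emeasure (mu \<alpha>) A < \<infinity>" for A :: "'a set"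
  proof -
    define v where "v = measure (mu \<alpha>) A"
    have "v \<ge> 0" by (simp add: v_def)
    then consider "v = 0" | "0 < v" "v \<le> \<tau>" | "\<tau> < v" by linarith
    then show ?thesis
    proof cases
      case 1
      \<comment> \<open>The choice \<open>u = 0\<close>, \<open>L = 1\<close> shows that the
        perimeter is nonnegative, and \<open>Itilde\<close> vanishes at 0 through its factor
        \<open>v\<close>.\<close>
      have "ereal (0 / (2 * 1)) \<le> perimeter \<alpha> A"
        using A by (intro perimeter_ge) auto
      then show ?thesis using 1 \<tau> by (simp add: Itilde_def v_def[symmetric])
    next
      case 2
      have "C * (v * ln (1 / v) powr (1 + 1 / \<alpha>)) \<le> C1 * (v * ln (1 / v) powr (1 + 1 / \<alpha>))"
        using 2 by (intro mult_right_mono) (auto simp: C_def)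
      then have "ereal (C * (v * ln (1 / v) powr (1 + 1 / \<alpha>)))
          \<le> ereal (C1 * (v * ln (1 / v) powr (1 + 1 / \<alpha>)))"
        by simp
      also have "\<dots> \<le> perimeter \<alpha> A"
        unfolding v_def using small[OF A] 2 by (simp add: v_def)
      finally show ?thesis
        using 2 by (simp add: Itilde_def v_def[symmetric] mult.assoc)
    next
      case 3
      have "C * v powr ((real DIM('a) - 1) / real DIM('a)) \<le> C2 * v powr ((real DIM('a) - 1) / real DIM('a))"
        by (intro mult_right_mono) (auto simp: C_def)
      then have "ereal (C * v powr ((real DIM('a) - 1) / real DIM('a)))
          \<le> ereal (C2 * v powr ((real DIM('a) - 1) / real DIM('a)))"
        by simp
      also have "\<dots> \<le> perimeter \<alpha> A"
        unfolding v_def using large[OF A] 3 by (simp add: v_def)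
      finally show ?thesis
        using 3 by (simp add: Itilde_def v_def[symmetric])
    qed
  qed
  moreover have "C > 0" using C1 C2 by (simp add: C_def)
  ultimately show ?thesis using \<tau> by blast
qed

end
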